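(* A formula $\alpha\in\mathrm{Form}$ is provable in $\mathcal{L}_\Delta$ if, and only if, it is a tautology; that is, $\emptyset^\vdash=\emptyset^\models$.
   Context: Formulas: $\mathrm{Form}$ is the least set containing a fixed countably infinite set of propositional variables and closed under $\alpha\to\beta$, $\neg\alpha$, and $\delta(\langle\alpha_i\rangle)$ for every sequence $\langle\alpha_i\rangle=\alpha_1,\alpha_2,\dots$ indexed by $\omega$. Notation: $\langle\alpha\rangle$ is the constant sequence of value $\alpha$; $\alpha,\langle\beta_i\rangle$ is $\alpha,\beta_1,\beta_2,\dots$; $\langle\alpha_i\rangle_{i>1}$ is $\alpha_2,\alpha_3,\dots$; $\tfrac12\alpha:=\delta(\alpha,\langle\neg(\alpha\to\alpha)\rangle)$; a schema $\alpha\leftrightarrow\beta$ stands for the two schemas $\alpha\to\beta$ and $\beta\to\alpha$. The calculus $\mathcal{L}_\Delta$ has axiom schemata: (Ł1) $\alpha\to(\beta\to\alpha)$; (Ł2) $(\alpha\to\beta)\to((\beta\to\gamma)\to(\alpha\to\gamma))$; (Ł3) $((\alpha\to\beta)\to\beta)\to((\beta\to\alpha)\to\alpha)$; (Ł4) $(\neg\alpha\to\neg\beta)\to(\beta\to\alpha)$; (Δ1) $\neg(\delta(\langle\alpha_i\rangle)\to\tfrac12\alpha_1)\leftrightarrow\tfrac12\delta(\langle\alpha_i\rangle_{i>1})$; (Δ2) $\tfrac12\delta(\langle\alpha_i\rangle)\leftrightarrow\delta(\langle\tfrac12\alpha_i\rangle)$; (Δ3) $\delta(\langle\alpha\rangle)\leftrightarrow\alpha$;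 (Δ4) $\tfrac12\delta(\langle\alpha_i\rangle)\leftrightarrow\delta(\neg(\alpha\to\alpha),\langle\alpha_i\rangle)$; (Δ5) $\delta(\langle\alpha_i\rangle)\to\delta(\langle\neg\alpha_i\to\beta_i\rangle)$; (Δ6) $\tfrac12\neg(\alpha\to\beta)\leftrightarrow\neg(\tfrac12\alpha\to\tfrac12\beta)$; (Δ7) $\delta(\langle\alpha_i\to\beta_i\rangle)\to(\delta(\langle\alpha_i\rangle)\to\delta(\langle\beta_i\rangle))$. Rules: Modus Ponens and the $\delta$-rule (from $\alpha_i$ for all $i\in\omega$ infer $\delta(\langle\alpha_i\rangle)$). A proof of $\alpha$ from $\Theta$ is a sequence $(\alpha_i)_{i\in\eta+1}$ indexed by a successor ordinal with $\eta$ countable, $\alpha_\eta=\alpha$, each member an axiom, an element of $\Theta$, or obtained from earlier members by a rule. $\Theta^\vdash$ is the set of formulas provable from $\Theta$. Semantics: a valuation is a map $f\colon\mathrm{Form}\to[0,1]$ with $f(\neg\alpha)=1-f(\alpha)$, $f(\alpha\to\beta)=\min\{1,1-f(\alpha)+f(\beta)\}$, $f(\delta(\langle\alpha_i\rangle))=\sum_{i\ge1}f(\alpha_i)/2^i$. $f$ satisfies $\alpha$ if $f(\alpha)=1$. $\Theta^\models$ is the set of formulas satisfied by every valuation satisfying all of $\Theta$; tautologies are the elements of $\emptyset^\models$. *)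

theory Defs
  imports Complex_Main
begin

text \<open>Formulas: propositional variables indexed by nat (countably infinite),
  implication, negation, and the infinitary connective delta applied to an
  omega-sequence.  Sequences alpha_1, alpha_2, ... of the paper are indexed from 0 here:
  the paper's alpha_i is s (i - 1).\<close>

datatype form = Var nat | Imp form form | Neg form | Delta "nat \<Rightarrow> form"

definition half :: "form \<Rightarrow> form" where
  "half a = Delta (\<lambda>i. if i = 0 then a else Neg (Imp a a))"

inductive axiom :: "form \<Rightarrow> bool" where
  L1: "axiom (Imp a (Imp b a))"
| L2: "axiom (Imp (Imp a b) (Imp (Imp b c) (Imp a c)))"
| L3: "axiom (Imp (Imp (Imp a b) b) (Imp (Imp b a) a))"
| L4: "axiom (Imp (Imp (Neg a) (Neg b)) (Imp b a))"
| D1a: "axiom (Imp (Neg (Imp (Delta s) (half (s 0)))) (half (Delta (\<lambda>i. s (Suc i)))))"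
| D1b: "axiom (Imp (half (Delta (\<lambda>i. s (Suc i)))) (Neg (Imp (Delta s) (half (s 0)))))"
| D2a: "axiom (Imp (half (Delta s)) (Delta (\<lambda>i. half (s i))))"
| D2b: "axiom (Imp (Delta (\<lambda>i. half (s i))) (half (Delta s)))"
| D3a: "axiom (Imp (Delta (\<lambda>i. a)) a)"
| D3b: "axiom (Imp a (Delta (\<lambda>i. a)))"
| D4a: "axiom (Imp (half (Delta s)) (Delta (case_nat (Neg (Imp a a)) s)))"
| D4b: "axiom (Imp (Delta (case_nat (Neg (Imp a a)) s)) (half (Delta s)))"
| D5: "axiom (Imp (Delta s) (Delta (\<lambda>i. Imp (Neg (s i)) (t i))))"
| D6a: "axiom (Imp (half (Neg (Imp a b))) (Neg (Imp (half a) (half b))))"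
| D6b: "axiom (Imp (Neg (Imp (half a) (half b))) (half (Neg (Imp a b))))"
| D7: "axiom (Imp (Delta (\<lambda>i. Imp (s i) (t i))) (Imp (Delta s) (Delta t)))"

text \<open>A proof of a from Theta: a sequence indexed by a countable successor ordinal.
  It is represented by a well-order r on a set I of natural numbers (so the order type
  is a countable ordinal) having a greatest element last_ix (so it is a successor ordinal),
  together with the labelling p.  Each member is an axiom, a hypothesis, or follows from
  strictly earlier members by Modus Ponens or by the delta-rule.\<close>

definition strictly_before :: "nat rel \<Rightarrow> nat \<Rightarrow> nat \<Rightarrow> bool" where
  "strictly_before r j i \<longleftrightarrow> (j, i) \<in> r \<and> j \<noteq> i"

definition is_proof :: "form set \<Rightarrow> nat set \<Rightarrow> nat rel \<Rightarrow> (nat \<Rightarrow> form) \<Rightarrow> nat \<Rightarrow> bool" where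
  "is_proof \<Theta> I r p last_ix \<longleftrightarrow>
     well_order_on I r \<and> last_ix \<in> I \<and> (\<forall>i\<in>I. (i, last_ix) \<in> r) \<and>
     (\<forall>i\<in>I. axiom (p i) \<or> p i \<in> \<Theta>
        \<or> (\<exists>j\<in>I. \<exists>k\<in>I. strictly_before r j i \<and> strictly_before r k i \<and> p k = Imp (p j) (p i))
        \<or> (\<exists>s. p i = Delta s \<and> (\<forall>n. \<exists>j\<in>I. strictly_before r j i \<and> p j = s n)))"

definition provable_from :: "form set \<Rightarrow> form set" where
  "provable_from \<Theta> = {a. \<exists>I r p last_ix. is_proof \<Theta> I r p last_ix \<and> p last_ix = a}"

definition valuation :: "(form \<Rightarrow> real) \<Rightarrow> bool" where
  "valuation f \<longleftrightarrow>
     (\<forall>a. 0 \<le> f a \<and> f a \<le> 1) \<and>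
     (\<forall>a. f (Neg a) = 1 - f a) \<and>
     (\<forall>a b. f (Imp a b) = min 1 (1 - f a + f b)) \<and>
     (\<forall>s. f (Delta s) = (\<Sum>i. f (s i) / 2 ^ Suc i))"

definition consequences :: "form set \<Rightarrow> form set" where
  "consequences \<Theta> = {a. \<forall>f. valuation f \<and> (\<forall>b\<in>\<Theta>. f b = 1) \<longrightarrow> f a = 1}"

end

theory Submission
  imports Defs "HOL-Library.Nat_Bijection"
begin

text \<open>
  Formulas modulo provable equivalence form a Wajsberg (MV) algebra with a halving operation and
  an operation \<open>delta\<close>. A linear filter \<open>F\<close> turns the quotient into a chain containing the dyadic
  constants \<open>k / 2\<^sup>n\<close>, built by halving \<open>1\<close>; sending \<open>x\<close> to the supremum of the dyadic constants
  below \<open>x\<close> modulo \<open>F\<close> preserves implication, because every \<open>x\<close> lies between two consecutive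
  constants of denominator \<open>2\<^sup>n\<close>, and preserves \<open>delta\<close>, because (\<open>\<Delta>1\<close>) determines the binary
  expansion. If \<open>x \<noteq> 1\<close>, there is an \<open>n\<close> with \<open>\<not> x\<close> not below \<open>1 / 2\<^sup>n\<close>: the algebra
  is Archimedean. A linear filter omitting \<open>\<not> x \<rightarrow> 1 / 2\<^sup>n\<close> then gives a valuation refuting \<open>x\<close>.
\<close>

section \<open>Wajsberg algebras\<close>

locale wajsberg =
  fixes imp :: "'a \<Rightarrow> 'a \<Rightarrow> 'a" (infixr "\<rightharpoonup>" 65)
    and neg :: "'a \<Rightarrow> 'a"
    and one :: 'a
  assumes imp_weaken: "x \<rightharpoonup> (y \<rightharpoonup> x) = one"
    and one_imp [simp]: "one \<rightharpoonup> x = x"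
    and imp_syllogism: "(x \<rightharpoonup> y) \<rightharpoonup> ((y \<rightharpoonup> z) \<rightharpoonup> (x \<rightharpoonup> z)) = one"
    and imp_imp_commute: "(x \<rightharpoonup> y) \<rightharpoonup> y = (y \<rightharpoonup> x) \<rightharpoonup> x"
    and neg_imp_neg: "(neg x \<rightharpoonup> neg y) \<rightharpoonup> (y \<rightharpoonup> x) = one"
begin

definition le :: "'a \<Rightarrow> 'a \<Rightarrow> bool" (infix "\<sqsubseteq>" 50) where
  "x \<sqsubseteq> y \<longleftrightarrow> x \<rightharpoonup> y = one"

text \<open>The lattice supremum; its symmetry is exactly \<open>imp_imp_commute\<close>.\<close>

definition join :: "'a \<Rightarrow> 'a \<Rightarrow> 'a" where
  "join x y = (x \<rightharpoonup> y) \<rightharpoonup> y"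

text \<open>Lukasiewicz addition, truncated at \<open>one\<close>.\<close>

definition plus :: "'a \<Rightarrow> 'a \<Rightarrow> 'a" (infixl "\<oplus>" 70) where
  "x \<oplus> y = neg x \<rightharpoonup> y"

text \<open>Truncated subtraction, with value \<open>zero\<close> as soon as
  \<open>x \<sqsubseteq> y\<close>.\<close>

definition minus :: "'a \<Rightarrow> 'a \<Rightarrow> 'a" (infixl "\<ominus>" 70) where
  "x \<ominus> y = neg (x \<rightharpoonup> y)"

abbreviation zero :: 'a where
  "zero \<equiv> neg one"

section \<open>Order, negation and joins in a Wajsberg algebra\<close>

lemma imp_self [simp]: "x \<rightharpoonup> x = one"
  by (metis imp_syllogism one_imp)

lemma imp_one [simp]: "x \<rightharpoonup> one = one"
  by (metis imp_weaken one_imp)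

lemma le_refl [simp]: "x \<sqsubseteq> x"
  by (simp add: le_def)

lemma le_antisym: "x \<sqsubseteq> y \<Longrightarrow> y \<sqsubseteq> x \<Longrightarrow> x = y"
  unfolding le_def by (metis imp_imp_commute one_imp)

lemma le_trans [trans]: "x \<sqsubseteq> y \<Longrightarrow> y \<sqsubseteq> z \<Longrightarrow> x \<sqsubseteq> z"
  unfolding le_def by (metis imp_syllogism one_imp)

lemma le_one [simp]: "x \<sqsubseteq> one"
  by (simp add: le_def)

lemma imp_antimono: "x \<sqsubseteq> y \<Longrightarrow> y \<rightharpoonup> z \<sqsubseteq> x \<rightharpoonup> z"
  unfolding le_def by (metis imp_syllogism one_imp)

lemma le_join2: "y \<sqsubseteq> join x y"
  unfolding le_def join_def by (rule imp_weaken)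

lemma join_commute: "join x y = join y x"
  unfolding join_def by (rule imp_imp_commute)

lemma le_join1: "x \<sqsubseteq> join x y"
  by (metis join_commute le_join2)

text \<open>A syllogism gives the antecedent \<open>join y z\<close> on the right; \<open>y\<close>
  lies below this join, so antitonicity replaces it by \<open>y\<close>.\<close>

lemma imp_exchange_le: "x \<rightharpoonup> (y \<rightharpoonup> z) \<sqsubseteq> y \<rightharpoonup> (x \<rightharpoonup> z)"
proof -
  have "x \<rightharpoonup> (y \<rightharpoonup> z) \<sqsubseteq> join y z \<rightharpoonup> (x \<rightharpoonup> z)"
    unfolding le_def join_def by (rule imp_syllogism)
  also have "\<dots> \<sqsubseteq> y \<rightharpoonup> (x \<rightharpoonup> z)"
    by (intro imp_antimono le_join1)
  finally show ?thesis .
qed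

lemma imp_exchange: "x \<rightharpoonup> (y \<rightharpoonup> z) = y \<rightharpoonup> (x \<rightharpoonup> z)"
  by (intro le_antisym imp_exchange_le)

lemma imp_mono: "y \<sqsubseteq> z \<Longrightarrow> x \<rightharpoonup> y \<sqsubseteq> x \<rightharpoonup> z"
  unfolding le_def by (metis imp_exchange imp_syllogism one_imp)

lemma neg_imp_neg_le: "neg x \<rightharpoonup> neg y \<sqsubseteq> y \<rightharpoonup> x"
  unfolding le_def by (rule neg_imp_neg)

lemma le_imp: "x \<sqsubseteq> y \<rightharpoonup> x"
  unfolding le_def by (rule imp_weaken)

lemma zero_le [simp]: "zero \<sqsubseteq> x"
  by (metis le_imp le_trans neg_imp_neg_le one_imp)

lemma neg_eq_imp_zero: "neg x = x \<rightharpoonup> zero"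
proof (rule le_antisym)
  have "neg x \<sqsubseteq> neg zero \<rightharpoonup> neg x"
    by (rule le_imp)
  also have "\<dots> \<sqsubseteq> x \<rightharpoonup> zero"
    by (rule neg_imp_neg_le)
  finally show "neg x \<sqsubseteq> x \<rightharpoonup> zero" .
  \<comment> \<open>Double negation elimination comes first: padding by \<open>le_imp\<close>, then
    contraposition twice. With it the remaining inequality is one more contraposition.\<close>
  have "neg (neg x) \<sqsubseteq> neg (neg one) \<rightharpoonup> neg (neg x)"
    by (rule le_imp)
  also have "\<dots> \<sqsubseteq> neg x \<rightharpoonup> neg one"
    by (rule neg_imp_neg_le)
  also have "\<dots> \<sqsubseteq> one \<rightharpoonup> x"
    by (rule neg_imp_neg_le)
  finally have "neg (neg x) \<sqsubseteq> x"
    by simp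
  then have "x \<rightharpoonup> zero \<sqsubseteq> neg (neg x) \<rightharpoonup> neg one"
    by (rule imp_antimono)
  also have "\<dots> \<sqsubseteq> one \<rightharpoonup> neg x"
    by (rule neg_imp_neg_le)
  finally show "x \<rightharpoonup> zero \<sqsubseteq> neg x"
    by simp
qed

text \<open>By \<open>neg_eq_imp_zero\<close> a double negation is a join with \<open>zero\<close>,
  the least element.\<close>

lemma neg_neg [simp]: "neg (neg x) = x"
proof -
  have "neg (neg x) = join x zero"
    unfolding join_def using neg_eq_imp_zero by metis
  also have "\<dots> = x"
    unfolding join_commute[of x] using zero_le[of x] by (simp add: join_def le_def)
  finally show ?thesis .
qed

lemma contrapositive: "neg y \<rightharpoonup> neg x = x \<rightharpoonup> y"
  by (intro le_antisym) (metis neg_imp_neg_le neg_neg)+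

lemma contrapositive_le: "neg x \<sqsubseteq> neg y \<longleftrightarrow> y \<sqsubseteq> x"
  by (simp add: le_def contrapositive)

lemma join_absorb: "x \<sqsubseteq> y \<Longrightarrow> join x y = y"
  by (simp add: join_def le_def)

lemma join_least: "x \<sqsubseteq> z \<Longrightarrow> y \<sqsubseteq> z \<Longrightarrow> join x y \<sqsubseteq> z"
  by (metis imp_antimono join_absorb join_commute join_def)

lemma imp_le_join_imp_join: "x \<rightharpoonup> y \<sqsubseteq> join x z \<rightharpoonup> join y z"
proof -
  have "x \<rightharpoonup> y \<sqsubseteq> (y \<rightharpoonup> z) \<rightharpoonup> (x \<rightharpoonup> z)"
    unfolding le_def by (rule imp_syllogism)
  also have "\<dots> \<sqsubseteq> join x z \<rightharpoonup> join y z"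
    unfolding le_def join_def by (rule imp_syllogism)
  finally show ?thesis .
qed

text \<open>Detachment relative to a side disjunct \<open>z\<close>; it closes the enlarged set in
  \<open>dfilter_join\<close> under modus ponens.\<close>

lemma join_imp_le: "join (x \<rightharpoonup> y) z \<sqsubseteq> join x z \<rightharpoonup> join y z"
  by (meson imp_le_join_imp_join join_least le_imp le_join2 le_trans)

text \<open>Contraposition and exchange bring both sides to \<open>neg z\<close> implying the join
  of \<open>neg x\<close> and \<open>neg y\<close>, which is symmetric.\<close>

lemma imp_imp_exchange: "(x \<rightharpoonup> y) \<rightharpoonup> (x \<rightharpoonup> z) = (y \<rightharpoonup> x) \<rightharpoonup> (y \<rightharpoonup> z)"
proof -
  have "(u \<rightharpoonup> v) \<rightharpoonup> (u \<rightharpoonup> z) = neg z \<rightharpoonup> join (neg v) (neg u)" for u v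
    unfolding join_def by (metis contrapositive imp_exchange)
  then show ?thesis
    by (metis join_commute)
qed

lemma join_imp_cancel: "join x y \<rightharpoonup> y = x \<rightharpoonup> y"
proof (rule le_antisym)
  show "join x y \<rightharpoonup> y \<sqsubseteq> x \<rightharpoonup> y"
    by (intro imp_antimono le_join1)
  show "x \<rightharpoonup> y \<sqsubseteq> join x y \<rightharpoonup> y"
    by (metis join_def le_join1)
qed

text \<open>Once both implications are written as starting from the common join,
  \<open>imp_imp_exchange\<close> shows that the first implying the second is just the
  second.\<close>

lemma prelinear: "join (x \<rightharpoonup> y) (y \<rightharpoonup> x) = one"
proof -
  let ?j = "join x y"
  have "(x \<rightharpoonup> y) \<rightharpoonup> (y \<rightharpoonup> x) = (?j \<rightharpoonup> y) \<rightharpoonup> (?j \<rightharpoonup> x)"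
    by (metis join_imp_cancel join_commute)
  also have "\<dots> = (y \<rightharpoonup> ?j) \<rightharpoonup> (y \<rightharpoonup> x)"
    by (rule imp_imp_exchange)
  also have "\<dots> = y \<rightharpoonup> x"
    using le_join2[of y x] by (simp add: le_def)
  finally show ?thesis
    by (simp add: join_def)
qed

section \<open>Truncated addition and subtraction\<close>

lemma plus_assoc: "(x \<oplus> y) \<oplus> z = x \<oplus> (y \<oplus> z)"
  unfolding plus_def by (metis contrapositive imp_exchange neg_neg)

lemma plus_zero [simp]: "x \<oplus> zero = x" "zero \<oplus> x = x"
  unfolding plus_def by (metis neg_eq_imp_zero neg_neg) simp

lemma plus_mono: "x \<sqsubseteq> x' \<Longrightarrow> y \<sqsubseteq> y' \<Longrightarrow> x \<oplus> y \<sqsubseteq> x' \<oplus> y'"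
  unfolding plus_def by (meson contrapositive_le imp_antimono imp_mono le_trans)

lemma le_plus: "x \<sqsubseteq> y \<oplus> x"
  unfolding plus_def by (rule le_imp)

lemma imp_eq_plus: "x \<rightharpoonup> y = neg x \<oplus> y"
  by (simp add: plus_def)

lemma minus_le: "x \<ominus> y \<sqsubseteq> x"
proof -
  have "neg x \<sqsubseteq> x \<rightharpoonup> y"
    using le_imp[of "neg x" "neg y"] by (simp add: contrapositive)
  then have "neg (x \<rightharpoonup> y) \<sqsubseteq> neg (neg x)"
    by (simp only: contrapositive_le)
  then show ?thesis
    by (simp add: minus_def)
qed

lemma minus_plus_cancel: "y \<sqsubseteq> x \<Longrightarrow> x \<ominus> y \<oplus> y = x"
  using join_absorb[of y x] join_commute[of y x] by (simp add: join_def minus_def plus_def)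

text \<open>The assumption says that the sum is not truncated at \<open>one\<close>.\<close>

lemma plus_minus_cancel:
  assumes "x \<sqsubseteq> neg y"
  shows "(x \<oplus> y) \<ominus> y = x"
proof -
  have "y \<sqsubseteq> neg x"
    using assms contrapositive_le[of "neg y" x] by simp
  then have "join (neg x) y = neg x"
    using join_absorb join_commute by metis
  then show ?thesis
    by (simp add: minus_def plus_def join_def)
qed

lemma minus_plus: "x \<ominus> (y \<oplus> z) = x \<ominus> y \<ominus> z"
  by (simp add: minus_def imp_eq_plus plus_assoc)

text \<open>The left side is the negation of the join of \<open>neg x\<close> and
  \<open>neg y\<close>, that is, the meet of \<open>x\<close> and \<open>y\<close>.\<close>

lemma minus_minus:
  assumes "y \<sqsubseteq> x"
  shows "x \<ominus> (x \<ominus> y) = y"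
proof -
  have "x \<rightharpoonup> neg (x \<rightharpoonup> y) = join (neg x) (neg y)"
    using contrapositive[of "neg (x \<rightharpoonup> y)" x] join_commute[of "neg x" "neg y"]
    by (simp add: join_def contrapositive)
  then show ?thesis
    using assms by (simp add: minus_def join_absorb contrapositive_le)
qed

section \<open>Deductive filters and their linear extensions\<close>

definition dfilter :: "'a set \<Rightarrow> bool" where
  "dfilter F \<longleftrightarrow> one \<in> F \<and> (\<forall>x y. x \<in> F \<longrightarrow> x \<rightharpoonup> y \<in> F \<longrightarrow> y \<in> F)"

text \<open>A proper prime filter: the quotient by it is a nontrivial chain.\<close>

definition linear_dfilter :: "'a set \<Rightarrow> bool" where
  "linear_dfilter F \<longleftrightarrow> dfilter F \<and> zero \<notin> F \<and> (\<forall>x y. x \<rightharpoonup> y \<in> F \<or> y \<rightharpoonup> x \<in> F)"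

lemma dfilterI:
  "one \<in> F \<Longrightarrow> (\<And>x y. x \<in> F \<Longrightarrow> x \<rightharpoonup> y \<in> F \<Longrightarrow> y \<in> F) \<Longrightarrow> dfilter F"
  unfolding dfilter_def by blast

lemma dfilter_one: "dfilter F \<Longrightarrow> one \<in> F"
  by (simp add: dfilter_def)

lemma dfilter_mp: "dfilter F \<Longrightarrow> x \<rightharpoonup> y \<in> F \<Longrightarrow> x \<in> F \<Longrightarrow> y \<in> F"
  unfolding dfilter_def by blast

lemma dfilter_upward: "dfilter F \<Longrightarrow> x \<in> F \<Longrightarrow> x \<sqsubseteq> y \<Longrightarrow> y \<in> F"
  unfolding le_def by (metis dfilter_mp dfilter_one)

lemma dfilter_imp_trans: "dfilter F \<Longrightarrow> x \<rightharpoonup> y \<in> F \<Longrightarrow> y \<rightharpoonup> z \<in> F \<Longrightarrow> x \<rightharpoonup> z \<in> F"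
  by (metis dfilter_mp dfilter_one imp_syllogism)

lemma dfilter_le: "dfilter F \<Longrightarrow> x \<sqsubseteq> y \<Longrightarrow> x \<rightharpoonup> y \<in> F"
  by (simp add: dfilter_one le_def)

text \<open>This enlargement of \<open>F\<close> is the one tested against maximality in
  \<open>linear_dfilter_omitting\<close>.\<close>

lemma dfilter_join:
  assumes "dfilter F"
  shows "dfilter {x. join x y \<in> F}" and "F \<subseteq> {x. join x y \<in> F}"
proof -
  show "dfilter {x. join x y \<in> F}"
    unfolding dfilter_def mem_Collect_eq
  proof (intro conjI allI impI)
    show "join one y \<in> F"
      using assms le_join1[of one y] by (meson dfilter_one dfilter_upward)
    fix u v
    assume "join u y \<in> F" "join (u \<rightharpoonup> v) y \<in> F"
    then show "join v y \<in> F"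
      using assms join_imp_le dfilter_upward dfilter_mp by meson
  qed
  show "F \<subseteq> {x. join x y \<in> F}"
    using assms le_join1 by (auto intro: dfilter_upward)
qed

text \<open>Zorn's lemma gives a filter maximal among those omitting \<open>w\<close>; maximality
  and prelinearity make it linear.\<close>

lemma linear_dfilter_omitting:
  assumes "w \<noteq> one"
  obtains F where "linear_dfilter F" and "w \<notin> F"
proof -
  let ?A = "{F. dfilter F \<and> w \<notin> F}"
  have "\<exists>M\<in>?A. \<forall>X\<in>?A. M \<subseteq> X \<longrightarrow> X = M"
  proof (rule subset_Zorn_nonempty)
    have "{one} \<in> ?A"
      using assms by (auto intro: dfilterI)
    then show "?A \<noteq> {}"
      by blast
    fix C
    assume "C \<noteq> {}" and chain: "subset.chain ?A C"
    then have C: "\<forall>F\<in>C. dfilter F \<and> w \<notin> F"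
      by (auto simp: subset.chain_def)
    have "y \<in> \<Union>C" if x: "x \<in> \<Union>C" and xy: "x \<rightharpoonup> y \<in> \<Union>C" for x y
    proof -
      obtain F G where FG: "F \<in> C" "x \<in> F" "G \<in> C" "x \<rightharpoonup> y \<in> G"
        using x xy by blast
      then have "F \<subseteq> G \<or> G \<subseteq> F"
        using chain by (auto simp: subset_chain_def)
      then show ?thesis
        using FG C dfilter_mp by (metis UnionI subsetD)
    qed
    moreover have "one \<in> \<Union>C"
      using \<open>C \<noteq> {}\<close> C dfilter_one by blast
    ultimately have "dfilter (\<Union>C)"
      by (rule dfilterI[rotated])
    then show "\<Union>C \<in> ?A"
      using C by blast
  qed
  then obtain F where F: "dfilter F" "w \<notin> F"
    and max: "\<And>G. dfilter G \<Longrightarrow> w \<notin> G \<Longrightarrow> F \<subseteq> G \<Longrightarrow> G = F"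
    by auto
  \<comment> \<open>The enlargement by \<open>y\<close> contains \<open>x\<close>, so it is strictly
    larger than \<open>F\<close> and by maximality contains \<open>w\<close>.\<close>
  have grow: "join w y \<in> F" if "join x y \<in> F" "x \<notin> F" for x y
    using max[of "{x. join x y \<in> F}"] dfilter_join[OF F(1), of y] that by auto
  have "x \<rightharpoonup> y \<in> F \<or> y \<rightharpoonup> x \<in> F" for x y
  proof (rule ccontr)
    assume contr: "\<not> ?thesis"
    have "join (x \<rightharpoonup> y) (y \<rightharpoonup> x) \<in> F"
      using F by (simp add: prelinear dfilter_one)
    then have "join w (y \<rightharpoonup> x) \<in> F"
      using grow contr by blast
    \<comment> \<open>Both disjuncts of prelinearity have now been traded for \<open>w\<close>, and
      \<open>join w w\<close> is \<open>w\<close>.\<close>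
    then have "join w w \<in> F"
      using grow contr by (metis join_commute)
    then show False
      using F by (simp add: join_def)
  qed
  moreover have "zero \<notin> F"
    using F zero_le dfilter_upward by blast
  ultimately show ?thesis
    using that F unfolding linear_dfilter_def by blast
qed

end

section \<open>Halving and dyadic constants\<close>

text \<open>The single equation is what \<open>D1a\<close> and \<open>D1b\<close> say of a constant
  sequence, in view of \<open>D3a\<close> and \<open>D3b\<close>.\<close>

locale halving_wajsberg = wajsberg +
  fixes half :: "'a \<Rightarrow> 'a"
  assumes minus_half: "x \<ominus> half x = half x"
begin

lemma half_le: "half x \<sqsubseteq> x"
  using minus_le[of x "half x"] by (simp add: minus_half)

lemma half_plus_half: "half x \<oplus> half x = x"
  using minus_plus_cancel[OF half_le, of x] by (simp add: minus_half)

definition unit :: "nat \<Rightarrow> 'a" where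
  "unit n = (half ^^ n) one"

text \<open>The dyadic number \<open>k / 2 ^ n\<close> as a \<open>k\<close>-fold truncated sum,
  hence constantly \<open>one\<close> from \<open>k = 2 ^ n\<close> on.\<close>

definition frac :: "nat \<Rightarrow> nat \<Rightarrow> 'a" where
  "frac n k = ((\<lambda>x. x \<oplus> unit n) ^^ k) zero"

lemma frac_0 [simp]: "frac n 0 = zero"
  by (simp add: frac_def)

lemma frac_Suc: "frac n (Suc k) = frac n k \<oplus> unit n"
  by (simp add: frac_def)

lemma frac_1: "frac n (Suc 0) = unit n"
  by (simp add: frac_Suc)

lemma frac_add: "frac n (j + k) = frac n j \<oplus> frac n k"
  by (induction k) (simp_all add: frac_Suc plus_assoc)

lemma unit_Suc: "unit (Suc n) = half (unit n)"
  by (simp add: unit_def)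

lemma frac_double: "frac (Suc n) (2 * k) = frac n k"
  by (induction k) (simp_all add: frac_Suc plus_assoc unit_Suc half_plus_half)

lemma frac_refine: "frac (m + n) (2 ^ m * k) = frac n k"
  by (induction m) (simp_all add: frac_double mult.assoc)

lemma frac_mono: "j \<le> k \<Longrightarrow> frac n j \<sqsubseteq> frac n k"
  by (metis frac_add le_plus le_add_diff_inverse2)

lemma neg_half: "neg (half x) = neg x \<oplus> half x"
  by (metis imp_eq_plus minus_def minus_half neg_neg)

text \<open>By \<open>neg_half\<close>, passing from \<open>n\<close> to \<open>Suc n\<close> adds
  one finer unit to the previous negation; refining doubles the numerator first.\<close>

lemma neg_unit: "neg (unit n) = frac n (2 ^ n - 1)"
proof (induction n)
  case 0
  show ?case
    by (simp add: unit_def)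
next
  case (Suc n)
  have "neg (unit (Suc n)) = frac (Suc n) (2 * (2 ^ n - 1)) \<oplus> unit (Suc n)"
    using Suc by (simp add: unit_Suc neg_half frac_double)
  also have "\<dots> = frac (Suc n) (Suc (2 * (2 ^ n - 1)))"
    by (simp add: frac_Suc)
  also have "Suc (2 * (2 ^ n - 1)) = 2 ^ Suc n - (1 :: nat)"
    using one_le_power[of "2 :: nat" n] unfolding power_Suc by linarith
  finally show ?case .
qed

text \<open>Each induction step subtracts one more \<open>unit n\<close>; the cancellation is exact
  because \<open>?a\<close> is at most \<open>neg (unit n)\<close>.\<close>

lemma neg_frac_le: "k \<le> 2 ^ n \<Longrightarrow> neg (frac n k) = frac n (2 ^ n - k)"
proof (induction k)
  case 0
  have "frac n (2 ^ n) = neg (unit n) \<oplus> unit n"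
    using frac_Suc[of n "2 ^ n - 1"] by (simp add: neg_unit)
  then show ?case
    by (simp add: plus_def)
next
  case (Suc k)
  let ?a = "frac n (2 ^ n - Suc k)"
  have "neg (frac n (Suc k)) = neg (frac n k) \<ominus> unit n"
    by (simp add: frac_Suc plus_def minus_def)
  also have "\<dots> = (?a \<oplus> unit n) \<ominus> unit n"
    using Suc frac_Suc[of n "2 ^ n - Suc k"] by (simp add: Suc_diff_Suc)
  also have "\<dots> = ?a"
    by (intro plus_minus_cancel) (auto simp: neg_unit intro!: frac_mono)
  finally show ?case .
qed

lemma frac_eq_one: "2 ^ n \<le> k \<Longrightarrow> frac n k = one"
  using neg_frac_le[of 0 n] frac_mono[of "2 ^ n" k n] by (auto intro: le_antisym)

lemma neg_frac: "neg (frac n k) = frac n (2 ^ n - k)"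
  using neg_frac_le[of k n] frac_eq_one[of n k] by (cases "k \<le> 2 ^ n") auto

text \<open>No side condition: subtraction on \<open>nat\<close> stops at 0 just where
  \<open>frac\<close> stops at \<open>one\<close>.\<close>

lemma imp_frac: "frac n j \<rightharpoonup> frac n k = frac n (2 ^ n - j + k)"
  by (simp add: imp_eq_plus neg_frac frac_add)

text \<open>Membership of \<open>frac n k \<rightharpoonup> x\<close> in \<open>F\<close> means that
  \<open>k / 2 ^ n\<close> is below \<open>x\<close> in the quotient. The bound on \<open>k\<close>
  keeps the set within [0,1], since \<open>frac n\<close> is constant beyond
  \<open>2 ^ n\<close>.\<close>

definition val :: "'a set \<Rightarrow> 'a \<Rightarrow> real" where
  "val F x = Sup {real k / 2 ^ n | k n. k \<le> 2 ^ n \<and> frac n k \<rightharpoonup> x \<in> F}"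

section \<open>Real values modulo a linear filter\<close>

context
  fixes F
  assumes F: "linear_dfilter F"
begin

lemma dfilter_F: "dfilter F"
  using F by (simp add: linear_dfilter_def)

text \<open>No unit collapses to \<open>zero\<close> modulo \<open>F\<close>:
  \<open>unit n \<rightharpoonup> unit (Suc n)\<close> equals \<open>neg (unit (Suc n))\<close>, so
  a collapse would pass down to \<open>unit 0\<close>, which is \<open>one\<close>.\<close>

lemma neg_unit_notin: "neg (unit n) \<notin> F"
proof (induction n)
  case 0
  show ?case
    using F by (simp add: unit_def linear_dfilter_def)
next
  case (Suc n)
  show ?case
  proof
    assume n: "neg (unit (Suc n)) \<in> F"
    have "unit n \<rightharpoonup> unit (Suc n) = neg (unit (Suc n))"
      by (simp add: unit_Suc neg_half imp_eq_plus)
    then have "unit n \<rightharpoonup> zero \<in> F"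
      using n dfilter_imp_trans[OF dfilter_F] by (metis neg_eq_imp_zero)
    then show False
      using Suc by (simp add: neg_eq_imp_zero[symmetric])
  qed
qed

text \<open>Dyadic constants stay distinct modulo \<open>F\<close>: if \<open>k < j\<close>, the
  implication lies below \<open>neg (unit n)\<close>.\<close>

lemma frac_imp_frac_in:
  assumes "frac n j \<rightharpoonup> frac n k \<in> F" and "j \<le> 2 ^ n"
  shows "j \<le> k"
proof (rule ccontr)
  assume "\<not> j \<le> k"
  then have "frac n (2 ^ n - j + k) \<sqsubseteq> neg (unit n)"
    using assms(2) unfolding neg_unit by (intro frac_mono) auto
  then show False
    using assms neg_unit_notin dfilter_upward[OF dfilter_F] by (auto simp: imp_frac)
qed

lemma val_set_le_one:
  assumes "r \<in> {real k / 2 ^ n | k n. k \<le> 2 ^ n \<and> frac n k \<rightharpoonup> x \<in> F}"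
  shows "r \<le> 1"
proof -
  obtain k n where r: "r = real k / 2 ^ n" and "k \<le> 2 ^ n"
    using assms by blast
  then have "real k \<le> real (2 ^ n)"
    by (simp only: of_nat_le_iff)
  then show ?thesis
    by (simp add: r)
qed

lemma val_ge:
  assumes "frac n k \<rightharpoonup> x \<in> F" and "k \<le> 2 ^ n"
  shows "real k / 2 ^ n \<le> val F x"
  unfolding val_def
proof (rule cSup_upper)
  show "real k / 2 ^ n \<in> {real k / 2 ^ n | k n. k \<le> 2 ^ n \<and> frac n k \<rightharpoonup> x \<in> F}"
    using assms by blast
  show "bdd_above {real k / 2 ^ n | k n. k \<le> 2 ^ n \<and> frac n k \<rightharpoonup> x \<in> F}"
    using val_set_le_one by (rule bdd_aboveI)
qed

lemma zero_imp_in: "zero \<rightharpoonup> x \<in> F"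
  using zero_le by (rule dfilter_le[OF dfilter_F])

lemma val_set_nonempty: "{real k / 2 ^ n | k n. k \<le> 2 ^ n \<and> frac n k \<rightharpoonup> x \<in> F} \<noteq> {}"
proof -
  have "real 0 / 2 ^ 0 \<in> {real k / 2 ^ n | k n. k \<le> 2 ^ n \<and> frac n k \<rightharpoonup> x \<in> F}"
    using zero_imp_in[of x] frac_0[of 0] by (metis (mono_tags, lifting) le0 mem_Collect_eq)
  then show ?thesis
    by blast
qed

lemma val_nonneg: "0 \<le> val F x"
  using val_ge[of 0 0 x] zero_imp_in by simp

lemma val_le_one: "val F x \<le> 1"
  unfolding val_def using val_set_nonempty val_set_le_one by (rule cSup_least)

lemma val_le:
  assumes "x \<rightharpoonup> frac n k \<in> F"
  shows "val F x \<le> real k / 2 ^ n"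
  unfolding val_def
proof (rule cSup_least[OF val_set_nonempty])
  fix r
  assume "r \<in> {real k / 2 ^ n | k n. k \<le> 2 ^ n \<and> frac n k \<rightharpoonup> x \<in> F}"
  then obtain j m where r: "r = real j / 2 ^ m" and j: "j \<le> 2 ^ m" and jx: "frac m j \<rightharpoonup> x \<in> F"
    by blast
  have "frac m j \<rightharpoonup> frac n k \<in> F"
    using dfilter_F jx assms by (rule dfilter_imp_trans)
  \<comment> \<open>Both fractions are brought to the denominator \<open>2 ^ (n + m)\<close>, where
    numerators can be compared.\<close>
  then have "frac (n + m) (2 ^ n * j) \<rightharpoonup> frac (n + m) (2 ^ m * k) \<in> F"
    by (simp only: frac_refine frac_refine[of m n k, unfolded add.commute[of m n]])
  then have "2 ^ n * j \<le> 2 ^ m * k"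
    using j by (rule_tac frac_imp_frac_in) (auto simp: power_add)
  then have "real (2 ^ n * j) \<le> real (2 ^ m * k)"
    by (simp only: of_nat_le_iff)
  then show "r \<le> real k / 2 ^ n"
    by (simp add: r field_simps)
qed

text \<open>Take the least numerator whose constant lies above \<open>x\<close>; its predecessor
  does not, so by linearity it lies below. If the least one is 0, the bracket starts at 0.\<close>

lemma frac_bracket:
  obtains k where "k < 2 ^ n" "frac n k \<rightharpoonup> x \<in> F" "x \<rightharpoonup> frac n (Suc k) \<in> F"
proof -
  define m where "m = (LEAST m. x \<rightharpoonup> frac n m \<in> F)"
  have top: "x \<rightharpoonup> frac n (2 ^ n) \<in> F"
    using dfilter_one[OF dfilter_F] by (simp add: frac_eq_one)
  then have m: "x \<rightharpoonup> frac n m \<in> F"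
    unfolding m_def by (rule LeastI)
  have mle: "m \<le> 2 ^ n"
    unfolding m_def using top by (rule Least_le)
  show ?thesis
  proof (cases m)
    case 0
    then have "x \<rightharpoonup> frac n (Suc 0) \<in> F"
      using m frac_mono[of 0 "Suc 0" n] dfilter_imp_trans[OF dfilter_F] dfilter_le[OF dfilter_F] by blast
    then show ?thesis
      using that[of 0] zero_imp_in by simp
  next
    case (Suc k)
    then have "x \<rightharpoonup> frac n k \<notin> F"
      using not_less_Least[of k "\<lambda>m. x \<rightharpoonup> frac n m \<in> F"] by (simp add: m_def)
    then have "frac n k \<rightharpoonup> x \<in> F"
      using F by (auto simp: linear_dfilter_def)
    then show ?thesis
      using that[of k] m mle Suc by simp
  qed
qed

text \<open>Both arguments are known up to \<open>1 / 2 ^ n\<close>, and on the bracketing constants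
  \<open>imp_frac\<close> computes the implication. Letting \<open>n\<close> grow gives
  \<open>val_imp\<close>.\<close>

lemma val_imp_approx:
  "\<bar>val F (x \<rightharpoonup> y) - min 1 (1 - val F x + val F y)\<bar> \<le> 2 * (1 / 2) ^ n"
proof -
  obtain k where k: "k < 2 ^ n" "frac n k \<rightharpoonup> x \<in> F" "x \<rightharpoonup> frac n (Suc k) \<in> F"
    by (rule frac_bracket)
  obtain l where l: "l < 2 ^ n" "frac n l \<rightharpoonup> y \<in> F" "y \<rightharpoonup> frac n (Suc l) \<in> F"
    by (rule frac_bracket)
  define N :: real where "N = 2 ^ n"
  have N: "N > 0"
    by (simp add: N_def)
  have antimono: "(v \<rightharpoonup> w) \<rightharpoonup> (u \<rightharpoonup> w) \<in> F" if "u \<rightharpoonup> v \<in> F" for u v w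
    using dfilter_F that by (rule dfilter_upward) (simp add: le_def imp_syllogism)
  have mono: "(w \<rightharpoonup> u) \<rightharpoonup> (w \<rightharpoonup> v) \<in> F" if "u \<rightharpoonup> v \<in> F" for u v w
    using dfilter_F that
    by (rule dfilter_upward) (simp add: le_def imp_syllogism imp_exchange[of "u \<rightharpoonup> v" "w \<rightharpoonup> u" "w \<rightharpoonup> v"])
  \<comment> \<open>Implication is antitone on the left, so the lower bound pairs the upper end
    \<open>Suc k\<close> with the lower end \<open>l\<close>; the upper bound pairs \<open>k\<close>
    with \<open>Suc l\<close>.\<close>
  have "(frac n (Suc k) \<rightharpoonup> frac n l) \<rightharpoonup> (x \<rightharpoonup> y) \<in> F"
    using dfilter_imp_trans[OF dfilter_F antimono mono] k l by blast
  then have low: "frac n (2 ^ n - Suc k + l) \<rightharpoonup> (x \<rightharpoonup> y) \<in> F"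
    by (simp add: imp_frac)
  have "(x \<rightharpoonup> y) \<rightharpoonup> (frac n k \<rightharpoonup> frac n (Suc l)) \<in> F"
    using dfilter_imp_trans[OF dfilter_F antimono mono] k l by blast
  then have up: "(x \<rightharpoonup> y) \<rightharpoonup> frac n (2 ^ n - k + Suc l) \<in> F"
    by (simp add: imp_frac)
  have vx: "real k / N \<le> val F x" "val F x \<le> (real k + 1) / N"
    using val_ge[OF k(2)] val_le[OF k(3)] k(1) by (auto simp: N_def add.commute)
  have vy: "real l / N \<le> val F y" "val F y \<le> (real l + 1) / N"
    using val_ge[OF l(2)] val_le[OF l(3)] l(1) by (auto simp: N_def add.commute)
  have "val F (x \<rightharpoonup> y) \<le> (N - real k + (real l + 1)) / N"
    using val_le[OF up] k(1) by (simp add: N_def of_nat_diff algebra_simps)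
  then have up': "val F (x \<rightharpoonup> y) \<le> 1 - real k / N + real l / N + 1 / N"
    using N by (simp add: field_simps)
  have low': "min 1 (1 - real k / N - 1 / N + real l / N) \<le> val F (x \<rightharpoonup> y)"
  proof (cases "2 ^ n - Suc k + l \<le> 2 ^ n")
    case True
    have "(N - (real k + 1) + real l) / N \<le> val F (x \<rightharpoonup> y)"
      using val_ge[OF low True] k(1) by (simp add: N_def of_nat_diff algebra_simps)
    then show ?thesis
      using N by (simp add: add_divide_distrib diff_divide_distrib)
  next
    case False
    \<comment> \<open>The numerator is too large for \<open>val_ge\<close>; the constant is
      \<open>one\<close>, rewritten with denominator \<open>2 ^ 0\<close>.\<close>
    then have "frac n (2 ^ n - Suc k + l) = frac 0 1"
      by (simp add: frac_eq_one)
    then show ?thesis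
      using val_ge[of 0 1 "x \<rightharpoonup> y"] low by simp
  qed
  define \<kappa> \<mu> \<epsilon> where "\<kappa> = real k / N" and "\<mu> = real l / N" and "\<epsilon> = 1 / N"
  have "(1 / 2) ^ n = \<epsilon>"
    by (simp add: N_def \<epsilon>_def power_divide)
  moreover have "\<kappa> \<le> val F x" "val F x \<le> \<kappa> + \<epsilon>" "\<mu> \<le> val F y" "val F y \<le> \<mu> + \<epsilon>"
    using vx vy by (simp_all add: \<kappa>_def \<mu>_def \<epsilon>_def add_divide_distrib)
  moreover have "val F (x \<rightharpoonup> y) \<le> 1 - \<kappa> + \<mu> + \<epsilon>" "min 1 (1 - \<kappa> - \<epsilon> + \<mu>) \<le> val F (x \<rightharpoonup> y)"
    using up' low' by (simp_all add: \<kappa>_def \<mu>_def \<epsilon>_def)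
  ultimately show ?thesis
    using val_le_one[of "x \<rightharpoonup> y"] by linarith
qed

lemma val_imp: "val F (x \<rightharpoonup> y) = min 1 (1 - val F x + val F y)"
proof -
  have "(\<lambda>n. 2 * (1 / 2 :: real) ^ n) \<longlonglongrightarrow> 2 * 0"
    by (intro tendsto_intros LIMSEQ_power_zero) simp
  then have "\<bar>val F (x \<rightharpoonup> y) - min 1 (1 - val F x + val F y)\<bar> \<le> 2 * 0"
    by (rule Lim_bounded2) (use val_imp_approx in blast)
  then show ?thesis
    by simp
qed

lemma val_zero: "val F zero = 0"
  using val_le[of zero 0 0] zero_imp_in[of zero] val_nonneg[of zero] by simp

lemma val_neg: "val F (neg x) = 1 - val F x"
  using val_nonneg[of x] by (subst neg_eq_imp_zero) (simp add: val_imp val_zero)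

text \<open>Since \<open>x \<rightharpoonup> half x\<close> is \<open>neg (half x)\<close>, an
  equation between reals results; its truncated case would make \<open>val F x\<close>
  negative.\<close>

lemma val_half: "val F (half x) = val F x / 2"
proof -
  have "x \<rightharpoonup> half x = neg (half x)"
    by (metis minus_def minus_half neg_neg)
  then have "min 1 (1 - val F x + val F (half x)) = 1 - val F (half x)"
    by (metis val_imp val_neg)
  then show ?thesis
    using val_nonneg[of x] val_nonneg[of "half x"] by linarith
qed

lemma val_mono: "x \<sqsubseteq> y \<Longrightarrow> val F x \<le> val F y"
  using val_imp[of x y] val_neg[of one] val_zero by (simp add: le_def)

end

end

section \<open>Archimedean property, series for \<open>delta\<close>, separation from
  \<open>one\<close>\<close>

section \<open>Delta algebras\<close>

locale delta_algebra = halving_wajsberg +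
  fixes delta :: "(nat \<Rightarrow> 'a) \<Rightarrow> 'a"
  assumes delta_minus_head: "delta s \<ominus> half (s 0) = half (delta (\<lambda>i. s (Suc i)))"
    and half_delta: "half (delta s) = delta (\<lambda>i. half (s i))"
    and half_head_le: "half (s 0) \<sqsubseteq> delta s"
    and half_minus: "half (x \<ominus> y) = half x \<ominus> half y"
begin

text \<open>\<open>half\<close> distributes over differences, so the sum is first rewritten by
  differences from \<open>one\<close>. The assumption says that doubling is not truncated.\<close>

lemma half_double:
  assumes "y \<sqsubseteq> half one"
  shows "half (y \<oplus> y) = y"
proof -
  have neg: "neg x = one \<ominus> x" for x
    by (simp add: minus_def)
  have "y \<oplus> y = one \<ominus> (one \<ominus> y \<ominus> y)"
    by (simp add: neg[symmetric] plus_def minus_def)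
  then have "half (y \<oplus> y) = half one \<ominus> (half one \<ominus> half y \<ominus> half y)"
    by (simp add: half_minus)
  also have "\<dots> = half one \<ominus> (half one \<ominus> y)"
    by (simp add: minus_plus[symmetric] half_plus_half)
  also have "\<dots> = y"
    using assms by (rule minus_minus)
  finally show ?thesis .
qed

text \<open>With \<open>y n = 2\<^sup>n x\<close>, halving shifts the sequence \<open>y\<close>, so \<open>delta (y 1, y 2, \<dots>)\<close>
  does not change when its head \<open>x\<close> is subtracted.\<close>

lemma archimedean:
  assumes "\<And>n. x \<sqsubseteq> unit n"
  shows "x = zero"
proof -
  define y where "y n = ((\<lambda>u. u \<oplus> u) ^^ n) x" for n
  \<comment> \<open>Infinitesimals are closed under doubling; the bound by \<open>unit 1\<close>
    then feeds \<open>half_double\<close>.\<close>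
  have y_unit: "y n \<sqsubseteq> unit m" for n m
  proof (induction n arbitrary: m)
    case 0
    show ?case
      using assms by (simp add: y_def)
  next
    case (Suc n)
    have "y n \<oplus> y n \<sqsubseteq> unit (Suc m) \<oplus> unit (Suc m)"
      by (intro plus_mono Suc)
    then show ?case
      by (simp add: y_def unit_Suc half_plus_half)
  qed
  have half_y: "half (y (Suc n)) = y n" for n
    using half_double[of "y n"] y_unit[of n 1] by (simp add: y_def unit_def)
  define z where "z = delta (\<lambda>i. y (Suc i))"
  have head: "half (y (Suc 0)) = x"
    by (simp only: half_y) (simp add: y_def)
  have "z \<ominus> x = half (delta (\<lambda>i. y (Suc (Suc i))))"
    using delta_minus_head[of "\<lambda>i. y (Suc i)"] by (simp add: z_def head)
  also have "\<dots> = z"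
    by (simp add: half_delta half_y z_def)
  finally have "z \<ominus> x = z" .
  moreover have "x \<sqsubseteq> z"
    using half_head_le[of "\<lambda>i. y (Suc i)"] by (simp add: z_def head)
  \<comment> \<open>Here \<open>x\<close> equals \<open>z \<ominus> (z \<ominus> x)\<close>, which
    is \<open>z \<ominus> z\<close>.\<close>
  ultimately show ?thesis
    using minus_minus[of x z] by (simp add: minus_def)
qed

text \<open>\<open>delta_minus_head\<close> becomes a recursion splitting off the head; after
  \<open>n\<close> rounds the remainder is at most \<open>1 / 2 ^ n\<close>.\<close>

lemma val_delta:
  assumes F: "linear_dfilter F"
  shows "val F (delta s) = (\<Sum>i. val F (s i) / 2 ^ Suc i)"
proof -
  have minus: "val F (x \<ominus> y) = val F x - val F y" if "y \<sqsubseteq> x" for x y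
    using val_mono[OF F that] by (simp add: minus_def val_neg[OF F] val_imp[OF F])
  have step: "val F (delta t) = val F (t 0) / 2 + val F (delta (\<lambda>i. t (Suc i))) / 2" for t
    using minus[OF half_head_le[of t]] unfolding delta_minus_head val_half[OF F] by linarith
  have partial: "val F (delta s) = (\<Sum>i<n. val F (s i) / 2 ^ Suc i) + val F (delta (\<lambda>i. s (i + n))) / 2 ^ n" for n
  proof (induction n)
    case 0
    show ?case
      by simp
  next
    case (Suc n)
    then show ?case
      by (simp add: step[of "\<lambda>i. s (i + n)"] add_divide_distrib)
  qed
  have "(\<lambda>n. val F (delta (\<lambda>i. s (i + n))) / 2 ^ n) \<longlonglongrightarrow> 0"
  proof (rule tendsto_sandwich[where f = "\<lambda>_. 0" and h = "\<lambda>n. (1 / 2) ^ n"])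
    show "(\<lambda>n. (1 / 2 :: real) ^ n) \<longlonglongrightarrow> 0"
      by (rule LIMSEQ_power_zero) simp
    show "\<forall>\<^sub>F n in sequentially. val F (delta (\<lambda>i. s (i + n))) / 2 ^ n \<le> (1 / 2) ^ n"
      by (simp add: power_divide divide_right_mono val_le_one[OF F])
    show "\<forall>\<^sub>F n in sequentially. 0 \<le> val F (delta (\<lambda>i. s (i + n))) / 2 ^ n"
      by (simp add: val_nonneg[OF F])
  qed simp
  then have "(\<lambda>n. val F (delta s) - val F (delta (\<lambda>i. s (i + n))) / 2 ^ n) \<longlonglongrightarrow> val F (delta s) - 0"
    by (intro tendsto_intros)
  moreover have "val F (delta s) - val F (delta (\<lambda>i. s (i + n))) / 2 ^ n = (\<Sum>i<n. val F (s i) / 2 ^ Suc i)" for n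
    using partial[of n] by simp
  ultimately have "(\<lambda>i. val F (s i) / 2 ^ Suc i) sums val F (delta s)"
    by (simp add: sums_def)
  then show ?thesis
    by (rule sums_unique)
qed

theorem linear_dfilter_separating:
  assumes "x \<noteq> one"
  obtains F where "linear_dfilter F" and "val F x < 1"
proof -
  have "neg x \<noteq> zero"
    using assms neg_neg by metis
  then obtain n where "\<not> neg x \<sqsubseteq> unit n"
    using archimedean by blast
  then obtain F where F: "linear_dfilter F" and "neg x \<rightharpoonup> unit n \<notin> F"
    using linear_dfilter_omitting unfolding le_def by blast
  \<comment> \<open>Linearity reverses the omitted implication, which bounds
    \<open>val F (neg x)\<close> away from 0.\<close>
  then have "frac n 1 \<rightharpoonup> neg x \<in> F"
    by (auto simp: linear_dfilter_def frac_1)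
  then have "1 / 2 ^ n \<le> val F (neg x)"
    using val_ge[OF F, of n 1 "neg x"] by simp
  moreover have "(0 :: real) < 1 / 2 ^ n"
    by simp
  ultimately have "val F x < 1"
    unfolding val_neg[OF F] by linarith
  with F show ?thesis
    by (rule that)
qed

end

section \<open>Concatenating countably many proofs\<close>

section \<open>Transfinite proofs\<close>

text \<open>An inference step freed from positions: only the set \<open>B\<close> of formulas
  already obtained matters, so proofs can be re-indexed.\<close>

definition follows_from :: "form set \<Rightarrow> form set \<Rightarrow> form \<Rightarrow> bool" where
  "follows_from \<Theta> B a \<longleftrightarrow> axiom a \<or> a \<in> \<Theta> \<or> (\<exists>b\<in>B. Imp b a \<in> B) \<or> (\<exists>s. a = Delta s \<and> range s \<subseteq> B)"

lemma is_proof_iff: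
  "is_proof \<Theta> I r p l \<longleftrightarrow> well_order_on I r \<and> l \<in> I \<and> (\<forall>i\<in>I. (i, l) \<in> r) \<and>
    (\<forall>i\<in>I. follows_from \<Theta> (p ` {j \<in> I. strictly_before r j i}) (p i))"
proof -
  have "(\<exists>b\<in>p ` {j \<in> I. strictly_before r j i}. Imp b (p i) \<in> p ` {j \<in> I. strictly_before r j i}) \<longleftrightarrow>
      (\<exists>j\<in>I. \<exists>k\<in>I. strictly_before r j i \<and> strictly_before r k i \<and> p k = Imp (p j) (p i))" for i
    by (auto simp: image_iff) metis+
  moreover have "range s \<subseteq> p ` {j \<in> I. strictly_before r j i} \<longleftrightarrow>
      (\<forall>n. \<exists>j\<in>I. strictly_before r j i \<and> p j = s n)" for s :: "nat \<Rightarrow> form" and i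
    by (simp add: subset_iff image_iff) metis
  ultimately show ?thesis
    unfolding is_proof_def follows_from_def by (simp only:)
qed

lemma follows_from_mono: "follows_from \<Theta> B a \<Longrightarrow> B \<subseteq> C \<Longrightarrow> follows_from \<Theta> C a"
  unfolding follows_from_def by blast

text \<open>The ordinal sum of the orders \<open>r n\<close>. Well-foundedness is an induction on
  the block number with an inner induction along \<open>r n\<close>.\<close>

lemma well_order_on_lex_sum:
  fixes I :: "nat \<Rightarrow> 'a set"
  assumes wo: "\<And>n. well_order_on (I n) (r n)"
  defines "J \<equiv> {(n, i). i \<in> I n}"
  defines "S \<equiv> {((m, i), (n, j)). i \<in> I m \<and> j \<in> I n \<and> (m < n \<or> m = n \<and> (i, j) \<in> r n)}"
  shows "well_order_on J S"
proof -
  have "r n \<subseteq> I n \<times> I n" "\<forall>i\<in>I n. (i, i) \<in> r n" "trans (r n)" "antisym (r n)" "total_on (I n) (r n)"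
    and wf: "wf (r n - Id)" for n
    using wo[of n] by (simp_all add: order_on_defs refl_on_def)
  note r = this(1-5)
  have "S \<subseteq> J \<times> J" "refl_on J S"
    using r(2) by (auto simp: S_def J_def refl_on_def)
  moreover have "trans S"
    unfolding S_def by (rule transI) (auto dest: transD[OF r(3)])
  moreover have "antisym S"
    unfolding S_def by (rule antisymI) (auto dest: antisymD[OF r(4)])
  moreover have "total_on J S"
  proof (rule total_onI)
    fix x y
    assume "x \<in> J" "y \<in> J" "x \<noteq> y"
    then obtain m i n j where xy: "x = (m, i)" "y = (n, j)" "i \<in> I m" "j \<in> I n"
      by (auto simp: J_def)
    consider "m < n" | "n < m" | "m = n"
      by linarith
    then show "(x, y) \<in> S \<or> (y, x) \<in> S"
      using xy r(5)[of n] \<open>x \<noteq> y\<close> by cases (auto simp: S_def total_on_def)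
  qed
  moreover have "wf (S - Id)"
  proof (rule wfUNIVI)
    fix P x
    assume step: "\<forall>x. (\<forall>y. (y, x) \<in> S - Id \<longrightarrow> P y) \<longrightarrow> P x"
    have "P (n, i)" for n i
    proof (induction n arbitrary: i rule: less_induct)
      case (less n)
      show ?case
        using wf[of n]
      proof (induction i rule: wf_induct_rule)
        case inner: (less i)
        show ?case
          by (rule step[rule_format]) (use less.IH inner.IH in \<open>auto simp: S_def\<close>)
      qed
    qed
    then show "P x"
      by (cases x) simp
  qed
  ultimately show ?thesis
    by (simp add: order_on_defs)
qed

text \<open>Transport along \<open>enc\<close> plus a new greatest element, so that the order type
  becomes a successor.\<close>

lemma well_order_on_add_top:
  fixes enc :: "'a \<Rightarrow> 'b"
  assumes wo: "well_order_on J S" and inj: "inj enc" and top: "t \<notin> range enc"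
  defines "K \<equiv> insert t (enc ` J)"
  defines "R \<equiv> {(enc x, enc y) | x y. (x, y) \<in> S} \<union> K \<times> {t}"
  shows "well_order_on K R"
proof -
  have S: "S \<subseteq> J \<times> J" "\<forall>i\<in>J. (i, i) \<in> S" "trans S" "antisym S" "total_on J S" and wf: "wf (S - Id)"
    using wo by (simp_all add: order_on_defs refl_on_def)
  have t: "enc x \<noteq> t" "t \<noteq> enc x" for x
    using top by auto
  have "R \<subseteq> K \<times> K" "refl_on K R"
    using S(1,2) by (auto simp: R_def K_def refl_on_def)
  moreover have "trans R"
    using S(1) unfolding R_def K_def
    by (intro transI) (auto simp: t inj_eq[OF inj] dest: transD[OF S(3)])
  moreover have "antisym R"
    unfolding R_def by (rule antisymI) (auto simp: t inj_eq[OF inj] dest: antisymD[OF S(4)])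
  moreover have "total_on K R"
    using S(5) unfolding R_def K_def total_on_def by (auto simp: t inj_eq[OF inj])
  moreover have "wf (R - Id)"
  proof (rule wfUNIVI)
    fix P x
    assume step: "\<forall>x. (\<forall>y. (y, x) \<in> R - Id \<longrightarrow> P y) \<longrightarrow> P x"
    have enc: "P (enc u)" for u
      using wf
    proof (induction u rule: wf_induct_rule)
      case (less u)
      show ?case
        by (rule step[rule_format]) (use less.IH in \<open>auto simp: R_def t inj_eq[OF inj]\<close>)
    qed
    have "P y" if "(y, x) \<in> R - Id" for y
      using that enc unfolding R_def K_def by auto
    then show "P x"
      using step by blast
  qed
  ultimately show ?thesis
    by (simp add: order_on_defs)
qed

text \<open>Proofs of \<open>s 0\<close>, \<open>s 1\<close>, ... are placed one after another, and
  \<open>a\<close> is appended at the end.\<close>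

lemma provable_from_follows:
  fixes s :: "nat \<Rightarrow> form"
  assumes s: "\<And>n. s n \<in> provable_from \<Theta>" and a: "follows_from \<Theta> (range s) a"
  shows "a \<in> provable_from \<Theta>"
proof -
  have "\<forall>n. \<exists>I r p l. is_proof \<Theta> I r p l \<and> p l = s n"
    using s by (simp add: provable_from_def)
  then obtain I r p l where pr: "\<And>n. is_proof \<Theta> (I n) (r n) (p n) (l n)" and pl: "\<And>n. p n (l n) = s n"
    by metis
  define J where "J = {(n, i). i \<in> I n}"
  define S where "S = {((m, i), (n, j)). i \<in> I m \<and> j \<in> I n \<and> (m < n \<or> m = n \<and> (i, j) \<in> r n)}"
  \<comment> \<open>The \<open>Suc\<close> leaves position 0 free for the final formula.\<close>
  define enc where "enc x = Suc (prod_encode x)" for x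
  define K where "K = insert 0 (enc ` J)"
  define R where "R = {(enc x, enc y) | x y. (x, y) \<in> S} \<union> K \<times> {0}"
  define q where "q i = (if i = 0 then a else case_prod p (prod_decode (i - 1)))" for i
  have q: "q 0 = a" "q (enc (n, i)) = p n i" for n i
    by (simp_all add: q_def enc_def)
  have "inj enc" "0 \<notin> range enc"
    by (auto simp: enc_def inj_def)
  moreover have "well_order_on J S"
    unfolding J_def S_def by (rule well_order_on_lex_sum) (use pr in \<open>simp add: is_proof_iff\<close>)
  ultimately have "well_order_on K R"
    unfolding K_def R_def by (intro well_order_on_add_top)
  moreover have "follows_from \<Theta> (q ` {j \<in> K. strictly_before R j 0}) (q 0)"
    unfolding q(1) using a
  proof (rule follows_from_mono)
    have "s n = q (enc (n, l n))" for n
      by (simp only: q pl)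
    moreover have "enc (n, l n) \<in> K" "strictly_before R (enc (n, l n)) 0" for n
      using pr[of n] by (auto simp: K_def J_def R_def strictly_before_def is_proof_iff enc_def)
    ultimately show "range s \<subseteq> q ` {j \<in> K. strictly_before R j 0}"
      by blast
  qed
  moreover have "follows_from \<Theta> (q ` {j \<in> K. strictly_before R j (enc (n, i))}) (q (enc (n, i)))"
    if i: "i \<in> I n" for n i
  proof (rule follows_from_mono)
    show "follows_from \<Theta> (p n ` {j \<in> I n. strictly_before (r n) j i}) (q (enc (n, i)))"
      using pr[of n] i by (simp add: is_proof_iff q)
    \<comment> \<open>Predecessors within block \<open>n\<close> remain predecessors in the sum, so
      every old step stays justified.\<close>
    have "enc (n, j) \<in> {j \<in> K. strictly_before R j (enc (n, i))}" if "j \<in> I n" "strictly_before (r n) j i" for j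
      using that i by (auto simp: K_def J_def R_def S_def strictly_before_def enc_def)
    then show "p n ` {j \<in> I n. strictly_before (r n) j i} \<subseteq> q ` {j \<in> K. strictly_before R j (enc (n, i))}"
      by (auto simp: q(2)[of n, symmetric] intro!: imageI)
  qed
  ultimately have "is_proof \<Theta> K R q 0"
    by (auto simp: is_proof_iff K_def R_def J_def)
  then show ?thesis
    using q(1) by (auto simp: provable_from_def)
qed

lemma provable_from_axiom:
  assumes "axiom a"
  shows "a \<in> provable_from \<Theta>"
proof -
  have "is_proof \<Theta> {0} {(0, 0)} (\<lambda>_. a) 0"
    using assms by (auto simp: is_proof_def order_on_defs refl_on_def trans_def antisym_def)
  then show ?thesis
    by (auto simp: provable_from_def)
qed

lemma provable_from_mp:
  assumes "Imp a b \<in> provable_from \<Theta>" and "a \<in> provable_from \<Theta>"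
  shows "b \<in> provable_from \<Theta>"
proof (rule provable_from_follows)
  \<comment> \<open>Two premises are presented as a sequence, with \<open>Imp a b\<close> repeated
    from place 1 on.\<close>
  let ?s = "\<lambda>n :: nat. if n = 0 then a else Imp a b"
  show "?s n \<in> provable_from \<Theta>" for n
    using assms by simp
  have "range ?s = {a, Imp a b}"
    by auto
  then show "follows_from \<Theta> (range ?s) b"
    by (auto simp: follows_from_def)
qed

lemma provable_from_delta: "(\<And>n. s n \<in> provable_from \<Theta>) \<Longrightarrow> Delta s \<in> provable_from \<Theta>"
  by (rule provable_from_follows[of s]) (auto simp: follows_from_def)

section \<open>Axioms and rules under a valuation\<close>

section \<open>Soundness\<close>

context
  fixes f :: "form \<Rightarrow> real"
  assumes f: "valuation f"
begin

lemma valuation_bounds: "0 \<le> f a" "f a \<le> 1"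
  and valuation_Neg: "f (Neg a) = 1 - f a"
  and valuation_Imp: "f (Imp a b) = min 1 (1 - f a + f b)"
  and valuation_Delta: "f (Delta s) = (\<Sum>i. f (s i) / 2 ^ Suc i)"
  using f by (auto simp: valuation_def)

lemma valuation_summable: "summable (\<lambda>i. f (s i) / 2 ^ Suc i)"
proof (rule summable_comparison_test')
  show "summable (\<lambda>i. (1 / 2 :: real) ^ i)"
    by (rule summable_geometric) simp
  show "norm (f (s i) / 2 ^ Suc i) \<le> (1 / 2) ^ i" if "0 \<le> i" for i
    using valuation_bounds[of "s i"] by (simp add: field_simps power_divide)
qed

lemma valuation_Delta_mono:
  assumes "\<And>i. f (s i) \<le> f (t i)"
  shows "f (Delta s) \<le> f (Delta t)"
  unfolding valuation_Delta
  by (intro suminf_le valuation_summable divide_right_mono assms) simp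

lemma valuation_Delta_const: "f (Delta s) = c" if "\<And>i. f (s i) = c"
proof -
  have "(\<lambda>i. c * (1 / 2) ^ Suc i) sums (c * 1)"
    by (intro sums_mult power_half_series)
  then show ?thesis
    unfolding valuation_Delta using that by (simp add: power_divide sums_iff)
qed

lemma valuation_Delta_head: "f (Delta s) = f (s 0) / 2 + f (Delta (\<lambda>i. s (Suc i))) / 2"
proof -
  have "(\<Sum>i. f (s (Suc i)) / 2 ^ Suc (Suc i)) = (\<Sum>i. f (s (Suc i)) / 2 ^ Suc i) / 2"
    using suminf_divide[OF valuation_summable[of "\<lambda>i. s (Suc i)"], of 2] by (simp add: field_simps)
  then show ?thesis
    unfolding valuation_Delta using suminf_split_head[OF valuation_summable[of s]] by simp
qed

lemma valuation_half: "f (half a) = f a / 2"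
  unfolding half_def
  by (subst valuation_Delta_head) (simp add: valuation_Delta_const valuation_Neg valuation_Imp)

lemma valuation_Delta_half: "f (Delta (\<lambda>i. half (s i))) = f (Delta s) / 2"
  unfolding valuation_Delta valuation_half using suminf_divide[OF valuation_summable[of s], of 2]
  by (simp add: field_simps)

text \<open>The truncation at 1 is dropped in each term, and the weights sum to 1.\<close>

lemma valuation_Delta_Imp: "f (Delta (\<lambda>i. Imp (s i) (t i))) \<le> 1 - f (Delta s) + f (Delta t)"
proof -
  have "(\<lambda>i. f (s i) / 2 ^ Suc i) sums f (Delta s)" "(\<lambda>i. f (t i) / 2 ^ Suc i) sums f (Delta t)"
    unfolding valuation_Delta by (intro summable_sums valuation_summable)+
  then have sums: "(\<lambda>i. (1 / 2) ^ Suc i - f (s i) / 2 ^ Suc i + f (t i) / 2 ^ Suc i) sums (1 - f (Delta s) + f (Delta t))"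
    by (intro sums_add sums_diff power_half_series)
  have "f (Imp (s i) (t i)) / 2 ^ Suc i \<le> (1 / 2) ^ Suc i - f (s i) / 2 ^ Suc i + f (t i) / 2 ^ Suc i" for i
  proof -
    have "f (Imp (s i) (t i)) / 2 ^ Suc i \<le> (1 - f (s i) + f (t i)) / 2 ^ Suc i"
      by (intro divide_right_mono) (simp_all add: valuation_Imp)
    then show ?thesis
      by (simp add: add_divide_distrib diff_divide_distrib power_divide)
  qed
  then show ?thesis
    using sums_le[OF _ summable_sums[OF valuation_summable] sums] by (simp add: valuation_Delta)
qed

lemma valuation_axiom: "axiom a \<Longrightarrow> f a = 1"
proof (induction rule: axiom.induct)
  case (D7 s t)
  then show ?case
    using valuation_Delta_Imp[of s t] valuation_bounds[of "Delta (\<lambda>i. Imp (s i) (t i))"]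
    by (simp add: valuation_Imp)
next
  case (D5 s t)
  have "f (Delta s) \<le> f (Delta (\<lambda>i. Imp (Neg (s i)) (t i)))"
    using valuation_bounds by (intro valuation_Delta_mono) (simp add: valuation_Imp valuation_Neg)
  then show ?case
    by (simp add: valuation_Imp)
next
  case (D1a s)
  then show ?case
    using valuation_bounds[of "Delta (\<lambda>i. s (Suc i))"]
    by (simp add: valuation_Imp valuation_Neg valuation_half valuation_Delta_head[of s])
next
  case (D1b s)
  then show ?case
    using valuation_bounds[of "Delta (\<lambda>i. s (Suc i))"]
    by (simp add: valuation_Imp valuation_Neg valuation_half valuation_Delta_head[of s])
next
  case (D4a s a)
  then show ?case
    by (simp add: valuation_Imp valuation_Neg valuation_half valuation_Delta_head[of "case_nat _ _"])
next
  case (D4b s a)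
  then show ?case
    by (simp add: valuation_Imp valuation_Neg valuation_half valuation_Delta_head[of "case_nat _ _"])
next
  case (L1 a b)
  then show ?case
    using valuation_bounds[of a] valuation_bounds[of b] by (simp add: valuation_Imp)
next
  case (L2 a b c)
  then show ?case
    by (simp add: valuation_Imp min_def)
next
  case (L3 a b)
  then show ?case
    by (simp add: valuation_Imp min_def)
next
  case (D6a a b)
  then show ?case
    by (simp add: valuation_Imp valuation_Neg valuation_half min_def field_simps)
next
  case (D6b a b)
  then show ?case
    by (simp add: valuation_Imp valuation_Neg valuation_half min_def field_simps)
qed (simp_all add: valuation_Imp valuation_Neg valuation_half valuation_Delta_half valuation_Delta_const)

lemma valuation_follows:
  assumes "follows_from \<Theta> B a" and "\<forall>b\<in>\<Theta>. f b = 1" and "\<forall>b\<in>B. f b = 1"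
  shows "f a = 1"
  using assms(1) unfolding follows_from_def
proof (elim disjE exE conjE bexE)
  fix b
  assume "b \<in> B" "Imp b a \<in> B"
  then have "f b = 1" "f (Imp b a) = 1"
    using assms by auto
  then show ?thesis
    using valuation_bounds[of a] by (simp add: valuation_Imp)
next
  fix s
  assume "a = Delta s" "range s \<subseteq> B"
  then show ?thesis
    using assms by (auto intro!: valuation_Delta_const)
qed (use assms valuation_axiom in auto)

end

text \<open>Well-founded induction along the order of the proof, with
  \<open>valuation_follows\<close> at each position.\<close>

theorem soundness: "provable_from \<Theta> \<subseteq> consequences \<Theta>"
proof
  fix a
  assume "a \<in> provable_from \<Theta>"
  then obtain I r p l where pr: "is_proof \<Theta> I r p l" and a: "p l = a"
    by (auto simp: provable_from_def)
  have "f (p i) = 1" if f: "valuation f" "\<forall>b\<in>\<Theta>. f b = 1" and "i \<in> I" for f i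
  proof -
    have "wf (r - Id)"
      using pr by (simp add: is_proof_iff order_on_defs)
    then show ?thesis
      using \<open>i \<in> I\<close>
    proof (induction i rule: wf_induct_rule)
      case (less i)
      have "follows_from \<Theta> (p ` {j \<in> I. strictly_before r j i}) (p i)"
        using pr less.prems by (simp add: is_proof_iff)
      then show ?case
        by (rule valuation_follows[OF f(1) _ f(2)]) (use less.IH in \<open>auto simp: strictly_before_def\<close>)
    qed
  qed
  moreover have "l \<in> I"
    using pr by (simp add: is_proof_iff)
  ultimately show "a \<in> consequences \<Theta>"
    using a by (auto simp: consequences_def)
qed

section \<open>The Lindenbaum algebra\<close>

abbreviation derivable :: "form \<Rightarrow> bool" ("\<turnstile> _" [60] 60) where
  "\<turnstile> a \<equiv> a \<in> provable_from {}"

section \<open>Derived laws of the calculus\<close>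

lemma derivable_trans: "\<turnstile> Imp a b \<Longrightarrow> \<turnstile> Imp b c \<Longrightarrow> \<turnstile> Imp a c"
  using provable_from_axiom[OF L2] provable_from_mp by blast

lemma derivable_weaken: "\<turnstile> b \<Longrightarrow> \<turnstile> Imp a b"
  using provable_from_axiom[OF L1] provable_from_mp by blast

text \<open>Weakening \<open>t\<close> gives \<open>Imp (Imp a t) t\<close>, the antecedent of an
  instance of \<open>L3\<close>.\<close>

lemma derivable_Imp_elim: "\<turnstile> t \<Longrightarrow> \<turnstile> Imp (Imp t a) a"
  using provable_from_axiom[OF L3] provable_from_mp derivable_weaken by blast

lemma derivable_refl: "\<turnstile> Imp a a"
  using derivable_trans[OF provable_from_axiom[OF L1] derivable_Imp_elim[OF provable_from_axiom[OF L1]]] .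

lemma derivable_Imp_mono1: "\<turnstile> Imp a' a \<Longrightarrow> \<turnstile> Imp (Imp a b) (Imp a' b)"
  using provable_from_axiom[OF L2] provable_from_mp by blast

lemma derivable_Imp_mono2: "\<turnstile> Imp b b' \<Longrightarrow> \<turnstile> Imp (Imp a b) (Imp a b')"
  by (rule derivable_trans[OF provable_from_axiom[OF L2] derivable_Imp_elim])

text \<open>Padding and two contrapositions lead to \<open>Imp ?t a\<close>, where the derivable
  \<open>?t\<close> is dropped.\<close>

lemma derivable_Neg_Neg1: "\<turnstile> Imp (Neg (Neg a)) a"
proof -
  let ?t = "Imp a a"
  have "\<turnstile> Imp (Neg (Neg a)) (Imp (Neg (Neg ?t)) (Neg (Neg a)))"
    by (rule provable_from_axiom[OF L1])
  moreover have "\<turnstile> Imp (Imp (Neg (Neg ?t)) (Neg (Neg a))) (Imp (Neg a) (Neg ?t))"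
    by (rule provable_from_axiom[OF L4])
  moreover have "\<turnstile> Imp (Imp (Neg a) (Neg ?t)) (Imp ?t a)"
    by (rule provable_from_axiom[OF L4])
  moreover have "\<turnstile> Imp (Imp ?t a) a"
    by (rule derivable_Imp_elim[OF derivable_refl])
  ultimately show ?thesis
    using derivable_trans by blast
qed

lemma derivable_Neg_Neg2: "\<turnstile> Imp a (Neg (Neg a))"
  using provable_from_axiom[OF L4] derivable_Neg_Neg1 by (rule provable_from_mp)

lemma derivable_Neg_mono:
  assumes "\<turnstile> Imp a b"
  shows "\<turnstile> Imp (Neg b) (Neg a)"
proof (rule provable_from_mp[OF provable_from_axiom[OF L4]])
  show "\<turnstile> Imp (Neg (Neg a)) (Neg (Neg b))"
    using assms derivable_trans derivable_Neg_Neg1 derivable_Neg_Neg2 by blast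
qed

lemma derivable_ex_falso: "\<turnstile> t \<Longrightarrow> \<turnstile> Imp (Neg t) c"
  using derivable_trans[OF derivable_trans[OF provable_from_axiom[OF L1] provable_from_axiom[OF L4]] derivable_Imp_elim] .

text \<open>The delta-rule gathers the pointwise implications into one formula, which
  \<open>D7\<close> then distributes.\<close>

lemma derivable_Delta_mono: "(\<And>i. \<turnstile> Imp (s i) (t i)) \<Longrightarrow> \<turnstile> Imp (Delta s) (Delta t)"
  using provable_from_mp[OF provable_from_axiom[OF D7] provable_from_delta] by blast

text \<open>The entries standing for zero differ between \<open>half a\<close> and
  \<open>half b\<close>; being refutable, they are compared by ex falso.\<close>

lemma derivable_half_mono: "\<turnstile> Imp a b \<Longrightarrow> \<turnstile> Imp (half a) (half b)"
  unfolding half_def by (rule derivable_Delta_mono) (simp add: derivable_ex_falso derivable_refl)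

lemma derivable_half_head: "\<turnstile> Imp (half (s 0)) (Delta s)"
  unfolding half_def by (rule derivable_Delta_mono) (simp add: derivable_ex_falso derivable_refl)

section \<open>The quotient by provable equivalence as a delta algebra\<close>

definition form_equiv :: "form \<Rightarrow> form \<Rightarrow> bool" where
  "form_equiv a b \<longleftrightarrow> \<turnstile> Imp a b \<and> \<turnstile> Imp b a"

quotient_type lindenbaum = form / form_equiv
proof (rule equivpI)
  show "reflp form_equiv"
    by (simp add: form_equiv_def reflp_def derivable_refl)
  show "symp form_equiv"
    by (simp add: form_equiv_def symp_def)
  show "transp form_equiv"
    unfolding form_equiv_def using derivable_trans by (intro transpI) blast
qed

lift_definition imp_L :: "lindenbaum \<Rightarrow> lindenbaum \<Rightarrow> lindenbaum" is Imp
  unfolding form_equiv_def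
  using derivable_trans[OF derivable_Imp_mono1 derivable_Imp_mono2] by blast

lift_definition neg_L :: "lindenbaum \<Rightarrow> lindenbaum" is Neg
  unfolding form_equiv_def using derivable_Neg_mono by blast

lift_definition half_L :: "lindenbaum \<Rightarrow> lindenbaum" is half
  unfolding form_equiv_def using derivable_half_mono by blast

lift_definition delta_L :: "(nat \<Rightarrow> lindenbaum) \<Rightarrow> lindenbaum" is Delta
  unfolding form_equiv_def rel_fun_def using derivable_Delta_mono by blast

text \<open>The class of all derivable formulas; \<open>Var 0\<close> is an arbitrary
  choice.\<close>

lift_definition one_L :: lindenbaum is "Imp (Var 0) (Var 0)" .

lemma form_equiv_one: "form_equiv a (Imp (Var 0) (Var 0)) \<longleftrightarrow> \<turnstile> a"
  unfolding form_equiv_def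
  using provable_from_mp[OF _ derivable_refl] derivable_weaken derivable_refl by blast

lemma abs_lindenbaum_eq_one: "abs_lindenbaum a = one_L \<longleftrightarrow> \<turnstile> a"
  unfolding one_L.abs_eq lindenbaum.abs_eq_iff by (rule form_equiv_one)

interpretation lindenbaum: wajsberg imp_L neg_L one_L
proof
  fix x y z
  show "imp_L x (imp_L y x) = one_L"
    by transfer (simp add: form_equiv_one provable_from_axiom L1)
  show "imp_L one_L x = x"
    by transfer (simp add: form_equiv_def provable_from_axiom L1 derivable_Imp_elim derivable_refl)
  show "imp_L (imp_L x y) (imp_L (imp_L y z) (imp_L x z)) = one_L"
    by transfer (simp add: form_equiv_one provable_from_axiom L2)
  show "imp_L (imp_L x y) y = imp_L (imp_L y x) x"
    by transfer (simp add: form_equiv_def provable_from_axiom L3)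
  show "imp_L (imp_L (neg_L x) (neg_L y)) (imp_L y x) = one_L"
    by transfer (simp add: form_equiv_one provable_from_axiom L4)
qed

lemma delta_L_const: "delta_L (\<lambda>_. x) = x"
  by transfer (simp add: form_equiv_def provable_from_axiom D3a D3b)

lemma delta_L_minus_head:
  "neg_L (imp_L (delta_L s) (half_L (s 0))) = half_L (delta_L (\<lambda>i. s (Suc i)))"
  by transfer (simp add: form_equiv_def provable_from_axiom D1a D1b)

interpretation lindenbaum: delta_algebra imp_L neg_L one_L half_L delta_L
proof
  fix x y s
  show "lindenbaum.minus x (half_L x) = half_L x"
    \<comment> \<open>On a constant sequence the head, the tail sum and the whole sum are all
      \<open>x\<close>.\<close>
    using delta_L_minus_head[of "\<lambda>_. x"] by (simp add: lindenbaum.minus_def delta_L_const)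
  show "lindenbaum.minus (delta_L s) (half_L (s 0)) = half_L (delta_L (\<lambda>i. s (Suc i)))"
    by (simp add: lindenbaum.minus_def delta_L_minus_head)
  show "half_L (delta_L s) = delta_L (\<lambda>i. half_L (s i))"
    by transfer (simp add: form_equiv_def provable_from_axiom D2a D2b)
  show "lindenbaum.le (half_L (s 0)) (delta_L s)"
    unfolding lindenbaum.le_def by transfer (simp add: form_equiv_one derivable_half_head)
  show "half_L (lindenbaum.minus x y) = lindenbaum.minus (half_L x) (half_L y)"
    unfolding lindenbaum.minus_def
    by transfer (simp add: form_equiv_def provable_from_axiom D6a D6b)
qed

text \<open>\<open>delta_L\<close> chooses representatives at all places at once; by
  \<open>derivable_Delta_mono\<close> this changes \<open>Delta s\<close> only up to
  equivalence.\<close>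

lemma abs_lindenbaum_Delta: "abs_lindenbaum (Delta s) = delta_L (\<lambda>i. abs_lindenbaum (s i))"
proof -
  have "form_equiv (s i) (rep_lindenbaum (abs_lindenbaum (s i)))" for i
    unfolding lindenbaum.abs_eq_iff[symmetric] by (metis Quotient3_abs_rep Quotient3_lindenbaum)
  then have "form_equiv (Delta s) (Delta (\<lambda>i. rep_lindenbaum (abs_lindenbaum (s i))))"
    unfolding form_equiv_def by (auto intro!: derivable_Delta_mono)
  then show ?thesis
    by (simp add: delta_L_def map_fun_def comp_def lindenbaum.abs_eq_iff)
qed

text \<open>The quotient map followed by \<open>val F\<close> respects all connectives.\<close>

lemma valuation_val:
  assumes F: "lindenbaum.linear_dfilter F"
  shows "valuation (\<lambda>a. lindenbaum.val F (abs_lindenbaum a))"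
  unfolding valuation_def
  by (auto simp: neg_L.abs_eq[symmetric] imp_L.abs_eq[symmetric] abs_lindenbaum_Delta
    lindenbaum.val_nonneg[OF F] lindenbaum.val_le_one[OF F] lindenbaum.val_neg[OF F]
    lindenbaum.val_imp[OF F] lindenbaum.val_delta[OF F])

theorem completeness: "consequences {} \<subseteq> provable_from {}"
proof
  fix a
  assume a: "a \<in> consequences {}"
  show "\<turnstile> a"
  proof (rule ccontr)
    assume "\<not> \<turnstile> a"
    then have "abs_lindenbaum a \<noteq> one_L"
      by (simp add: abs_lindenbaum_eq_one)
    then obtain F where F: "lindenbaum.linear_dfilter F" and "lindenbaum.val F (abs_lindenbaum a) < 1"
      by (rule lindenbaum.linear_dfilter_separating)
    with a valuation_val[OF F] show False
      by (fastforce simp: consequences_def)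
  qed
qed

theorem mainTheorem12:
  shows "provable_from {} = consequences {}"
  using soundness completeness by (rule subset_antisym)

end
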